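(* Let $f(z)=z+a_2z^2+\cdots$ belong to $\mathcal{UST}$. Then $$\operatorname{Re}\{a_2f(z)\}\ge-\frac12+\frac12(1-2|z|)\operatorname{Re}\left\{\frac{f(z)}{z}\right\}$$ for all $z\in\mathbb{D}$.
   Context: $\mathbb{D}=\{z\in\mathbb{C}:|z|<1\}$. $\mathcal{UST}$ is the class of uniformly starlike functions: analytic functions $f$ on $\mathbb{D}$ normalized by $f(0)=0$, $f'(0)=1$, that map every circular arc $\gamma\subset\mathbb{D}$ with center $a\in\mathbb{D}$ onto an arc starlike with respect to $f(a)$. Analytically, $f\in\mathcal{UST}$ if and only if $$\operatorname{Re}\left\{\frac{f'(z)(z-x)}{f(z)-f(x)}\right\}>0,\qquad x,z\in\mathbb{D}$$ (with $f(z)\ne f(x)$ for $z\neq x$, and the quotient given its limiting value $1$ at $z=x$); this may be taken as the definition. At $z=0$, $f(z)/z$ is understood as its limit $1$. *)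

theory Defs
  imports "HOL-Complex_Analysis.Complex_Analysis"
begin

(* On the diagonal the quotient f'(z)(z - x) / (f(z) - f(x)) is given its limiting value 1;
   the bare formula would evaluate to 0 there because of division by zero. *)
definition ust_quotient :: "(complex \<Rightarrow> complex) \<Rightarrow> complex \<Rightarrow> complex \<Rightarrow> complex" where
  "ust_quotient f x z = (if z = x then 1 else deriv f z * (z - x) / (f z - f x))"

(* Uniformly starlike functions, by their analytic characterization. Only the values of f on
   the unit disc matter. *)
definition UST :: "(complex \<Rightarrow> complex) set" where
  "UST = {f. f holomorphic_on ball 0 1 \<and> f 0 = 0 \<and> deriv f 0 = 1 \<and>
             (\<forall>x\<in>ball 0 1. \<forall>z\<in>ball 0 1. z \<noteq> x \<longrightarrow> f z \<noteq> f x) \<and>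
             (\<forall>x\<in>ball 0 1. \<forall>z\<in>ball 0 1. Re (ust_quotient f x z) > 0)}"

end

theory Submission
  imports Defs
begin

text \<open>For fixed x, the quotient p(z) = f'(z)(z - x)/(f(z) - f(x)) has positive real part on the disc,
  with p(0) = x/f(x) and p'(0) = (x/f(x))(2 a2 - 1/x + 1/f(x)). Caratheodory's bound
  |p'(0)| <= 2 Re p(0), multiplied by |f(x)|^2/|x|, reads
  |2 a2 f(x) - f(x)/x + 1| <= 2 |x| Re (f(x)/x), and taking real parts gives the claim.\<close>

text \<open>The Moebius map sending \<open>u\<close> to \<open>(u - c) / (u + cnj c)\<close> with
  \<open>c = p 0\<close> takes the right half-plane into the unit disc and \<open>c\<close> to 0.
  Its composition \<open>q\<close> with \<open>p\<close> therefore satisfies the Schwarz lemma, and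
  \<open>q'(0) = p'(0) / (2 Re c)\<close>.\<close>

lemma Caratheodory_deriv_bound:
  assumes holo: "p holomorphic_on ball 0 1"
    and pos: "\<And>z. z \<in> ball 0 1 \<Longrightarrow> Re (p z) > 0"
  shows "norm (deriv p 0) \<le> 2 * Re (p 0)"
proof -
  define c where "c = p 0"
  have c: "Re c > 0" using pos[of 0] by (simp add: c_def)
  have ne: "p z + cnj c \<noteq> 0" if "z \<in> ball 0 1" for z
  proof
    assume "p z + cnj c = 0"
    hence "Re (p z + cnj c) = 0" by simp
    with pos[OF that] c show False by simp
  qed
  define q where "q = (\<lambda>z. (p z - c) / (p z + cnj c))"
  have q_holo: "q holomorphic_on ball 0 1"
    unfolding q_def using ne by (intro holomorphic_intros holo) auto
  have q_lt: "norm (q z) < 1" if "norm z < 1" for z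
  proof -
    have z: "z \<in> ball 0 1" using that by simp
    \<comment> \<open>The numbers \<open>p z - c\<close> and \<open>p z + cnj c\<close> have the
      same imaginary part, so comparing their moduli comes down to the real parts.\<close>
    have "(Re (p z) + Re c)\<^sup>2 - (Re (p z) - Re c)\<^sup>2 = 4 * (Re (p z) * Re c)"
      by (simp add: power2_eq_square algebra_simps)
    moreover have "Re (p z) * Re c > 0" using pos[OF z] c by simp
    ultimately have "(norm (p z - c))\<^sup>2 < (norm (p z + cnj c))\<^sup>2"
      unfolding cmod_power2 by simp
    hence "norm (p z - c) < norm (p z + cnj c)"
      by (rule power_less_imp_less_base) simp
    thus ?thesis using ne[OF z] by (simp add: q_def norm_divide)
  qed
  have "q 0 = 0" by (simp add: q_def c_def)
  from Schwarz_Lemma(2)[OF q_holo this q_lt, of 0]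
  have q': "norm (deriv q 0) \<le> 1" by simp
  have p': "(p has_field_derivative deriv p 0) (at 0)"
    using holo by (intro holomorphic_derivI[of _ "ball 0 1"]) auto
  have "(q has_field_derivative deriv p 0 / (c + cnj c)) (at 0)"
    unfolding q_def using ne[of 0]
    by (auto intro!: derivative_eq_intros p' simp: c_def)
  hence "deriv q 0 = deriv p 0 / complex_of_real (2 * Re c)"
    unfolding complex_add_cnj by (rule DERIV_imp_deriv)
  with q' c show ?thesis by (simp add: norm_divide norm_mult c_def)
qed

text \<open>A zero of \<open>deriv f\<close> at \<open>z\<close> would make the quotient vanish for
  every \<open>x\<close> other than \<open>z\<close>, contradicting its positive real part.\<close>

lemma UST_deriv_nonzero:
  assumes "f \<in> UST" "z \<in> ball 0 1"
  shows "deriv f z \<noteq> 0"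
proof -
  define x :: complex where "x = (if z = 0 then 1 / 2 else 0)"
  have x: "x \<in> ball 0 1" "x \<noteq> z" by (auto simp: x_def norm_divide)
  have "Re (ust_quotient f x z) > 0" using assms x by (auto simp: UST_def)
  thus ?thesis using x(2) by (auto simp: ust_quotient_def)
qed

text \<open>The diagonal point \<open>x\<close> is a removable singularity: the quotient is
  holomorphic away from it, and the value 1 prescribed there makes it continuous.\<close>

lemma ust_quotient_holomorphic:
  assumes f: "f \<in> UST" and x: "x \<in> ball 0 1"
  shows "ust_quotient f x holomorphic_on ball 0 1"
proof -
  have holo: "f holomorphic_on ball 0 1" using f by (simp add: UST_def)
  have inj: "f z \<noteq> f x" if "z \<in> ball 0 1" "z \<noteq> x" for z
    using f x that by (auto simp: UST_def)
  have "(\<lambda>z. deriv f z * (z - x) / (f z - f x)) holomorphic_on ball 0 1 - {x}"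
    using inj by (intro holomorphic_intros holomorphic_on_subset[OF holo]
        holomorphic_on_subset[OF holomorphic_deriv[OF holo]]) auto
  hence off: "ust_quotient f x holomorphic_on ball 0 1 - {x}"
    by (rule holomorphic_transform) (simp add: ust_quotient_def)
  have "(f has_field_derivative deriv f x) (at x)"
    using holo x by (intro holomorphic_derivI[of _ "ball 0 1"]) auto
  hence slope: "((\<lambda>z. (f z - f x) / (z - x)) \<longlongrightarrow> deriv f x) (at x)"
    by (simp add: has_field_derivative_iff)
  have "continuous_on (ball 0 1) (deriv f)"
    by (intro holomorphic_on_imp_continuous_on holomorphic_deriv[OF holo]) auto
  hence "(deriv f \<longlongrightarrow> deriv f x) (at x)"
    using x by (simp add: continuous_on_eq_continuous_at isCont_def)
  \<comment> \<open>The quotient is \<open>deriv f z\<close> over the difference quotient of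
    \<open>f\<close>. Both tend to \<open>deriv f x\<close>, which is nonzero, so the limit is
    1.\<close>
  from tendsto_divide[OF this slope UST_deriv_nonzero[OF f x]]
  have "((\<lambda>z. deriv f z / ((f z - f x) / (z - x))) \<longlongrightarrow> 1) (at x)"
    using UST_deriv_nonzero[OF f x] by simp
  hence "(ust_quotient f x \<longlongrightarrow> ust_quotient f x x) (at x)"
    by (rule filterlim_cong[THEN iffD1, rotated -1])
       (auto simp: ust_quotient_def eventually_at_filter)
  hence cont_x: "isCont (ust_quotient f x) x" by (simp add: isCont_def)
  have "isCont (ust_quotient f x) z" if "z \<in> ball 0 1" for z
  proof (cases "z = x")
    case False
    have "continuous_on (ball 0 1 - {x}) (ust_quotient f x)"
      using off by (rule holomorphic_on_imp_continuous_on)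
    thus ?thesis using that False
      by (simp add: continuous_on_eq_continuous_at open_delete)
  qed (use cont_x in simp)
  hence "continuous_on (ball 0 1) (ust_quotient f x)"
    by (simp add: continuous_at_imp_continuous_on)
  from no_isolated_singularity[OF this off] show ?thesis by simp
qed

text \<open>The factor \<open>x / f x\<close> is the value at 0, and the bracket is the logarithmic
  derivative there: \<open>deriv f\<close> contributes \<open>f''(0) / f'(0) = 2 a2\<close>, the
  factor \<open>z - x\<close> contributes \<open>- 1 / x\<close>, and the denominator contributes
  \<open>1 / f x\<close>.\<close>

lemma ust_quotient_deriv_0:
  assumes f: "f \<in> UST" and x: "x \<in> ball 0 1" "x \<noteq> 0"
  shows "deriv (ust_quotient f x) 0 =
    x / f x * (2 * fps_nth (fps_expansion f 0) 2 - 1 / x + 1 / f x)"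
proof -
  have holo: "f holomorphic_on ball 0 1" and f0: "f 0 = 0" "deriv f 0 = 1"
    using f by (auto simp: UST_def)
  have fx: "f x \<noteq> 0" using f x by (force simp: UST_def)
  define a where "a = fps_nth (fps_expansion f 0) 2"
  have d1: "(f has_field_derivative 1) (at 0)"
    using holomorphic_derivI[OF holo, of 0] f0 by simp
  have "(deriv f has_field_derivative deriv (deriv f) 0) (at 0)"
    using holomorphic_derivI[OF holomorphic_deriv[OF holo], of 0] by simp
  moreover have "deriv (deriv f) 0 = 2 * a"
    by (simp add: a_def fps_expansion_def numeral_2_eq_2)
  ultimately have d2: "(deriv f has_field_derivative 2 * a) (at 0)" by simp
  have "((\<lambda>z. deriv f z * (z - x) / (f z - f x)) has_field_derivative
      x / f x * (2 * a - 1 / x + 1 / f x)) (at 0)"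
    using fx x by (auto intro!: derivative_eq_intros d1 d2 simp: f0 field_simps)
  \<comment> \<open>Since \<open>x\<close> is not 0, points near 0 avoid the diagonal, so the
    derivative of the bare formula is that of \<open>ust_quotient\<close>.\<close>
  moreover have "\<forall>\<^sub>F z in nhds 0. ust_quotient f x z = deriv f z * (z - x) / (f z - f x)"
    using x(2) by (intro eventually_mono[OF t1_space_nhds[of 0 x]])
      (auto simp: ust_quotient_def)
  ultimately have "(ust_quotient f x has_field_derivative
      x / f x * (2 * a - 1 / x + 1 / f x)) (at 0)"
    by (subst DERIV_cong_ev[OF refl _ refl]) auto
  thus ?thesis unfolding a_def by (rule DERIV_imp_deriv)
qed

theorem theorem2p15:
  fixes f :: "complex \<Rightarrow> complex" and a2 z :: complex
  assumes "f \<in> UST"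
    and "a2 = fps_nth (fps_expansion f 0) 2"
    and "z \<in> ball 0 1"
  shows "Re (a2 * f z) \<ge> - 1 / 2 + 1 / 2 * (1 - 2 * norm z) * Re (if z = 0 then 1 else f z / z)"
proof (cases "z = 0")
  \<comment> \<open>Both sides are 0 here, because \<open>f 0 = 0\<close> and the quotient has the
    limiting value 1.\<close>
  case True
  thus ?thesis using assms(1) by (simp add: UST_def)
next
  case False
  have f0: "f 0 = 0" "deriv f 0 = 1" using assms(1) by (auto simp: UST_def)
  have fz: "f z \<noteq> 0" using assms False by (force simp: UST_def)
  define w where "w = f z / z"
  have w: "w \<noteq> 0" "f z = w * z" using fz False by (auto simp: w_def)
  \<comment> \<open>The given \<open>z\<close> now plays the role of the fixed point
    \<open>x\<close>. Over the common denominator \<open>w^2 z\<close>, the derivative of the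
    quotient at 0 has numerator \<open>b\<close>.\<close>
  define b where "b = 2 * a2 * f z - w + 1"
  have "norm (deriv (ust_quotient f z) 0) \<le> 2 * Re (ust_quotient f z 0)"
    using assms by (intro Caratheodory_deriv_bound ust_quotient_holomorphic) (auto simp: UST_def)
  moreover have "ust_quotient f z 0 = 1 / w"
    using False f0 by (simp add: ust_quotient_def w_def)
  moreover have "deriv (ust_quotient f z) 0 = b / (w\<^sup>2 * z)"
    using ust_quotient_deriv_0[OF assms(1,3) False] False w(1)
    unfolding assms(2)[symmetric] b_def w(2) by (simp add: field_simps power2_eq_square)
  moreover have "Re (1 / w) = Re w / (norm w)\<^sup>2"
    by (simp add: Re_divide cmod_power2)
  ultimately have "norm b / ((norm w)\<^sup>2 * norm z) \<le> 2 * Re w / (norm w)\<^sup>2"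
    by (simp add: norm_divide norm_mult norm_power)
  hence "norm b \<le> 2 * norm z * Re w"
    using w(1) False by (simp add: divide_simps mult_ac)
  \<comment> \<open>The modulus bound is weakened to a lower bound on \<open>Re b\<close>; expanding
    \<open>Re b\<close> and halving gives the claim.\<close>
  moreover have "- Re b \<le> norm b"
    using abs_Re_le_cmod[of b] by linarith
  ultimately have "- Re b \<le> 2 * norm z * Re w" by linarith
  moreover have "Re b = 2 * Re (a2 * f z) - Re w + 1"
    by (simp add: b_def algebra_simps)
  ultimately show ?thesis using False by (simp add: w_def[symmetric] algebra_simps)
qed

end
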